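(* Let $\mathcal{A}\subseteq\mathcal{B}(\mathcal{H}_1)$ and $\mathcal{B}\subseteq\mathcal{B}(\mathcal{H}_2)$ be reflexive algebras. Any semi-normalizer (resp. normalizer) of $\mathcal{B}$ into $\mathcal{A}$ is the norm-limit of linear combinations of partial isometries in $SN(\mathcal{B},\mathcal{A})$ (resp. in $N(\mathcal{B},\mathcal{A})$).
   Context: All Hilbert spaces are complex and separable. Reflexive algebras are unital: $\mathcal{A}$ is reflexive if $\mathcal{A}=\{A:L^\perp AL=0\ \forall L\in\operatorname{Lat}\mathcal{A}\}$, where $\operatorname{Lat}\mathcal{A}$ is the lattice of projections $L$ with $L^\perp AL=0$ for all $A\in\mathcal{A}$ ($L^\perp=I-L$). $SN(\mathcal{B},\mathcal{A})=\{T\in\mathcal{B}(\mathcal{H}_1,\mathcal{H}_2):T^*\mathcal{B}T\subseteq\mathcal{A}\}$ is the set of semi-normalizers of $\mathcal{B}$ into $\mathcal{A}$, and $N(\mathcal{B},\mathcal{A})=\{T\in\mathcal{B}(\mathcal{H}_1,\mathcal{H}_2):T^*\mathcal{B}T\subseteq\mathcal{A}\text{ and }T\mathcal{A}T^*\subseteq\mathcal{B}\}$ is the set of normalizers. *)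

theory Defs
  imports "HOL-Analysis.Analysis"
begin

section \<open>Complex Hilbert spaces\<close>

class complex_vector = real_vector +
  fixes scaleC :: "complex \<Rightarrow> 'a \<Rightarrow> 'a"  (infixr "*\<^sub>C" 75)
  assumes scaleC_add_right: "c *\<^sub>C (x + y) = c *\<^sub>C x + c *\<^sub>C y"
    and scaleC_add_left: "(c + d) *\<^sub>C x = c *\<^sub>C x + d *\<^sub>C x"
    and scaleC_scaleC: "c *\<^sub>C d *\<^sub>C x = (c * d) *\<^sub>C x"
    and scaleC_one: "1 *\<^sub>C x = x"
    and scaleR_scaleC: "r *\<^sub>R x = complex_of_real r *\<^sub>C x"

global_interpretation complex_vector: vector_space "scaleC :: complex \<Rightarrow> 'a \<Rightarrow> 'a::complex_vector"
  defines cspan = complex_vector.span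
  by unfold_locales (simp_all add: scaleC_add_right scaleC_add_left scaleC_scaleC scaleC_one)

text \<open>The inner product is linear in the first and conjugate linear in the second argument.
  The norm and its topology are those of the underlying \<^class>\<open>real_normed_vector\<close>.\<close>

class complex_inner = complex_vector + real_normed_vector +
  fixes cinner :: "'a \<Rightarrow> 'a \<Rightarrow> complex"
  assumes cinner_commute: "cinner x y = cnj (cinner y x)"
    and cinner_add_left: "cinner (x + y) z = cinner x z + cinner y z"
    and cinner_scaleC_left: "cinner (c *\<^sub>C x) y = c * cinner x y"
    and cinner_self_norm: "cinner x x = complex_of_real ((norm x)\<^sup>2)"

class chilbert_space = complex_inner + complete_space

lemma norm_scaleC: "norm (c *\<^sub>C x) = cmod c * norm (x :: 'a::complex_inner)"
proof -
  have "complex_of_real ((norm (c *\<^sub>C x))\<^sup>2) = c * cinner x (c *\<^sub>C x)"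
    by (simp only: cinner_self_norm [symmetric] cinner_scaleC_left)
  also have "\<dots> = c * cnj (c * cinner x x)"
    by (simp only: cinner_commute [of x "c *\<^sub>C x"] cinner_scaleC_left)
  also have "\<dots> = complex_of_real ((cmod c * norm x)\<^sup>2)"
    by (simp add: cinner_self_norm power_mult_distrib complex_norm_square mult.assoc
        flip: of_real_power)
  finally have "(norm (c *\<^sub>C x))\<^sup>2 = (cmod c * norm x)\<^sup>2"
    by (simp only: of_real_eq_iff)
  then show ?thesis
    by (simp add: power2_eq_iff_nonneg)
qed


section \<open>Bounded operators\<close>

lemma bounded_linear_scaleC: "bounded_linear (\<lambda>x :: 'a::complex_inner. c *\<^sub>C x)"
proof (rule bounded_linear_intro [where K = "cmod c"])
  show "c *\<^sub>C (x + y) = c *\<^sub>C x + c *\<^sub>C y" for x y :: 'a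
    by (rule scaleC_add_right)
  show "c *\<^sub>C r *\<^sub>R x = r *\<^sub>R c *\<^sub>C x" for r and x :: 'a
    by (simp add: scaleR_scaleC scaleC_scaleC mult.commute)
  show "norm (c *\<^sub>C x) \<le> norm x * cmod c" for x :: 'a
    by (simp add: norm_scaleC)
qed

instantiation blinfun :: (real_normed_vector, complex_inner) complex_vector
begin

lift_definition scaleC_blinfun :: "complex \<Rightarrow> 'a \<Rightarrow>\<^sub>L 'b \<Rightarrow> 'a \<Rightarrow>\<^sub>L 'b"
  is "\<lambda>c f x. c *\<^sub>C f x"
  by (rule bounded_linear_compose [OF bounded_linear_scaleC])

instance
  by standard (transfer; simp add: scaleC_add_right scaleC_add_left scaleC_scaleC scaleC_one
      scaleR_scaleC fun_eq_iff)+

end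

text \<open>\<open>'a \<Rightarrow>\<^sub>L 'b\<close> consists of the real linear bounded maps; its norm is the operator norm. The
  complex linear ones form the space of bounded operators.\<close>

definition bounded_operators :: "('a::complex_inner \<Rightarrow>\<^sub>L 'b::complex_inner) set"
  where "bounded_operators = {T :: 'a \<Rightarrow>\<^sub>L 'b. \<forall>c x. T (c *\<^sub>C x) = c *\<^sub>C T x}"

definition adj :: "('a::chilbert_space \<Rightarrow>\<^sub>L 'b::chilbert_space) \<Rightarrow> 'b \<Rightarrow>\<^sub>L 'a"
  where "adj T = (THE S :: 'b \<Rightarrow>\<^sub>L 'a. \<forall>x y. cinner (T x) y = cinner x (S y))"

lemma adj_eqI:
  fixes T :: "'a::chilbert_space \<Rightarrow>\<^sub>L 'b::chilbert_space" and S :: "'b \<Rightarrow>\<^sub>L 'a"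
  assumes "\<And>x y. cinner (T x) y = cinner x (S y)"
  shows "adj T = S"
  unfolding adj_def
proof (rule the_equality)
  show "\<forall>x y. cinner (T x) y = cinner x (S y)"
    using assms by blast
next
  fix S' :: "'b \<Rightarrow>\<^sub>L 'a"
  assume S': "\<forall>x y. cinner (T x) y = cinner x (S' y)"
  show "S' = S"
  proof (rule blinfun_eqI)
    fix y
    define d where "d = S' y - S y"
    have "cinner (S' y) d = cinner (S y) d"
      using S' assms cinner_commute by metis
    moreover have "cinner (S' y) d = cinner d d + cinner (S y) d"
      by (simp add: d_def flip: cinner_add_left)
    ultimately have "cinner d d = 0"
      by simp
    then show "S' y = S y"
      by (simp add: cinner_self_norm d_def)
  qed
qed

definition is_projection :: "('a::chilbert_space \<Rightarrow>\<^sub>L 'a) \<Rightarrow> bool"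
  where "is_projection P \<longleftrightarrow> P \<in> bounded_operators \<and> P o\<^sub>L P = P \<and> adj P = P"

text \<open>A partial isometry is isometric on the orthogonal complement of its kernel.\<close>

definition is_partial_isometry :: "('a::chilbert_space \<Rightarrow>\<^sub>L 'b::chilbert_space) \<Rightarrow> bool"
  where "is_partial_isometry V \<longleftrightarrow> V \<in> bounded_operators \<and>
    (\<forall>x. (\<forall>z. V z = 0 \<longrightarrow> cinner x z = 0) \<longrightarrow> norm (V x) = norm x)"


section \<open>Reflexive algebras and normalizers\<close>

definition lat :: "('a::chilbert_space \<Rightarrow>\<^sub>L 'a) set \<Rightarrow> ('a \<Rightarrow>\<^sub>L 'a) set"
  where "lat \<A> = {L. is_projection L \<and> (\<forall>A\<in>\<A>. (id_blinfun - L) o\<^sub>L A o\<^sub>L L = 0)}"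

text \<open>That a reflexive set of operators is a unital algebra need not be required separately,
  see the lemma below.\<close>

definition reflexive_algebra :: "('a::chilbert_space \<Rightarrow>\<^sub>L 'a) set \<Rightarrow> bool"
  where "reflexive_algebra \<A> \<longleftrightarrow>
    \<A> = {A \<in> bounded_operators. \<forall>L\<in>lat \<A>. (id_blinfun - L) o\<^sub>L A o\<^sub>L L = 0}"

lemma reflexive_algebra_unital_algebra:
  assumes "reflexive_algebra \<A>"
  shows "id_blinfun \<in> \<A>"
    and "A \<in> \<A> \<Longrightarrow> B \<in> \<A> \<Longrightarrow> A + B \<in> \<A>"
    and "A \<in> \<A> \<Longrightarrow> c *\<^sub>C A \<in> \<A>"
    and "A \<in> \<A> \<Longrightarrow> B \<in> \<A> \<Longrightarrow> A o\<^sub>L B \<in> \<A>"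
proof -
  have blinfun_eq_iff: "A = B \<longleftrightarrow> (\<forall>x. A x = B x)" for A B :: "'a \<Rightarrow>\<^sub>L 'a"
    by (metis blinfun_eqI)
  have inv: "(id_blinfun - L) o\<^sub>L A o\<^sub>L L = 0 \<longleftrightarrow> (\<forall>x. L (A (L x)) = A (L x))"
    for L A :: "'a \<Rightarrow>\<^sub>L 'a"
    by (auto simp: blinfun_eq_iff minus_blinfun.rep_eq)
  have mem: "A \<in> \<A> \<longleftrightarrow> A \<in> bounded_operators \<and> (\<forall>L\<in>lat \<A>. \<forall>x. L (A (L x)) = A (L x))" for A
    using assms unfolding reflexive_algebra_def inv by blast
  have lat: "L \<in> bounded_operators" "L (L x) = L x" if "L \<in> lat \<A>" for L x
    using that by (auto simp: lat_def is_projection_def blinfun_eq_iff)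
  show "id_blinfun \<in> \<A>"
    using lat by (auto simp: mem bounded_operators_def)
  show "A + B \<in> \<A>" if "A \<in> \<A>" "B \<in> \<A>"
    using that
    by (auto simp: mem bounded_operators_def plus_blinfun.rep_eq scaleC_add_right blinfun.add_right)
  show "c *\<^sub>C A \<in> \<A>" if "A \<in> \<A>"
    using that lat
    by (auto simp: mem bounded_operators_def scaleC_blinfun.rep_eq scaleC_scaleC mult.commute)
  show "A o\<^sub>L B \<in> \<A>" if "A \<in> \<A>" "B \<in> \<A>"
  proof -
    have "L (A (B (L x))) = A (B (L x))" if "L \<in> lat \<A>" for L x
      using that \<open>A \<in> \<A>\<close> \<open>B \<in> \<A>\<close> unfolding mem by metis
    then show ?thesis
      using that by (auto simp: mem bounded_operators_def)
  qed
qed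

definition semi_normalizers ::
    "('b::chilbert_space \<Rightarrow>\<^sub>L 'b) set \<Rightarrow> ('a::chilbert_space \<Rightarrow>\<^sub>L 'a) set \<Rightarrow> ('a \<Rightarrow>\<^sub>L 'b) set"
  where "semi_normalizers \<B> \<A> =
    {T \<in> bounded_operators. \<forall>B\<in>\<B>. adj T o\<^sub>L B o\<^sub>L T \<in> \<A>}"

definition normalizers ::
    "('b::chilbert_space \<Rightarrow>\<^sub>L 'b) set \<Rightarrow> ('a::chilbert_space \<Rightarrow>\<^sub>L 'a) set \<Rightarrow> ('a \<Rightarrow>\<^sub>L 'b) set"
  where "normalizers \<B> \<A> =
    {T \<in> bounded_operators.
      (\<forall>B\<in>\<B>. adj T o\<^sub>L B o\<^sub>L T \<in> \<A>) \<and> (\<forall>A\<in>\<A>. T o\<^sub>L A o\<^sub>L adj T \<in> \<B>)}"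

end

theory Submission
  imports Defs
begin

text \<open>
  A semi-normalizer is characterized by projections: \<open>T\<^sup>* \<B> T \<subseteq> \<A>\<close> holds if and only if for
  every \<open>L \<in> lat \<A>\<close> there is a \<open>K \<in> lat \<B>\<close> with \<open>K T = T L\<close>
  (\<open>compression_mem_iff_intertwines_lat\<close>). Applied also to \<open>T\<^sup>*\<close>, this describes normalizers by
  adding the condition with the roles of \<open>K\<close> and \<open>L\<close> exchanged. Hence an operator that
  intertwines every pair of projections which \<open>T\<close> intertwines is a (semi-)normalizer whenever
  \<open>T\<close> is one.

  It remains to write \<open>T\<close> as a combination of partial isometries with this property. After
  scaling, \<open>norm T \<le> 1\<close>. Let \<open>T = V R\<close> be a polar decomposition, with \<open>R\<^sup>2 = T\<^sup>* T\<close>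
  self-adjoint, and let \<open>D\<close> be a square root of \<open>I - T\<^sup>* T\<close> commuting with \<open>R\<close>. Then
  \<open>R \<plusminus> \<i> D\<close> are unitary, and \<open>T\<close> is the mean of the partial isometries \<open>V (R + \<i> D)\<close> and
  \<open>V (R - \<i> D)\<close>. A relation \<open>K T = T L\<close> forces \<open>L\<close> to commute with \<open>T\<^sup>* T\<close>, hence with \<open>R\<close>
  and \<open>D\<close>, and it passes to \<open>V\<close> by continuity; so it passes to both partial isometries
  (\<open>contraction_mean_of_partial_isometries\<close>). In particular no limit has to be taken, and
  the spectral theorem is replaced by two square roots, each a norm limit of polynomials
  (\<open>operator_sqrt_exists\<close>).
\<close>

instance chilbert_space \<subseteq> banach ..

section \<open>The inner product\<close>

lemma cinner_add_right: "cinner x (y + z) = cinner x y + cinner x z"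
  by (metis cinner_add_left cinner_commute complex_cnj_add)

lemma cinner_scaleC_right: "cinner x (c *\<^sub>C y) = cnj c * cinner x y"
  by (metis cinner_scaleC_left cinner_commute complex_cnj_mult)

lemma cinner_zero_left [simp]: "cinner 0 x = 0"
  by (metis add_cancel_right_left cinner_add_left)

lemma cinner_zero_right [simp]: "cinner x 0 = 0"
  by (metis add_cancel_right_left cinner_add_right)

lemma cinner_minus_left [simp]: "cinner (- x) y = - cinner x y"
  by (metis add.right_inverse add_eq_0_iff cinner_add_left cinner_zero_left)

lemma cinner_minus_right [simp]: "cinner x (- y) = - cinner x y"
  by (metis add.right_inverse add_eq_0_iff cinner_add_right cinner_zero_right)

lemma cinner_diff_left: "cinner (x - y) z = cinner x z - cinner y z"
  by (simp only: diff_conv_add_uminus cinner_add_left cinner_minus_left)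

lemma cinner_diff_right: "cinner x (y - z) = cinner x y - cinner x z"
  by (simp only: diff_conv_add_uminus cinner_add_right cinner_minus_right)

lemma cinner_scaleR_left: "cinner (r *\<^sub>R x) y = r *\<^sub>R cinner x y"
  by (simp add: scaleR_scaleC cinner_scaleC_left scaleR_conv_of_real)

lemma cinner_scaleR_right: "cinner x (r *\<^sub>R y) = r *\<^sub>R cinner x y"
  by (simp add: scaleR_scaleC cinner_scaleC_right scaleR_conv_of_real)

lemmas cinner_linear =
  cinner_add_left cinner_add_right cinner_diff_left cinner_diff_right
  cinner_scaleC_left cinner_scaleC_right cinner_scaleR_left cinner_scaleR_right

lemma cinner_eq_zero_commute: "cinner x y = 0 \<longleftrightarrow> cinner y x = 0"
  by (metis cinner_commute complex_cnj_zero_iff)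

lemma norm_power2_eq_Re_cinner: "(norm x)\<^sup>2 = Re (cinner x x)"
  by (simp add: cinner_self_norm)

lemma Re_cinner_commute: "Re (cinner x y) = Re (cinner y x)"
  by (metis cinner_commute complex_cnj(1) complex.sel(1) cnj.simps(1))

lemma norm_add_power2: "(norm (x + y))\<^sup>2 = (norm x)\<^sup>2 + 2 * Re (cinner x y) + (norm y)\<^sup>2"
  using Re_cinner_commute [of x y] by (simp add: norm_power2_eq_Re_cinner cinner_linear)

lemma norm_diff_power2: "(norm (x - y))\<^sup>2 = (norm x)\<^sup>2 - 2 * Re (cinner x y) + (norm y)\<^sup>2"
  using Re_cinner_commute [of x y] by (simp add: norm_power2_eq_Re_cinner cinner_linear)

text \<open>The vector \<open>c *\<^sub>C y\<close> with \<open>c = \<langle>x, y\<rangle> / \<parallel>y\<parallel>\<^sup>2\<close> is the component of \<open>x\<close> along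
  \<open>y\<close>; removing it shortens \<open>x\<close> by the amount stated.\<close>

lemma norm_minus_component:
  assumes "y \<noteq> 0"
  shows "(norm (x - (cinner x y / complex_of_real ((norm y)\<^sup>2)) *\<^sub>C y))\<^sup>2
    = (norm x)\<^sup>2 - (cmod (cinner x y))\<^sup>2 / (norm y)\<^sup>2"
proof -
  define c where "c = cinner x y / complex_of_real ((norm y)\<^sup>2)"
  have "Re (cnj (cinner x y) * cinner x y) = (cmod (cinner x y))\<^sup>2"
    by (simp add: complex_norm_square [symmetric] mult.commute del: of_real_power)
  then have "Re (cinner x (c *\<^sub>C y)) = (cmod (cinner x y))\<^sup>2 / (norm y)\<^sup>2"
    by (simp add: c_def cinner_scaleC_right del: of_real_power)
  moreover have "(norm (c *\<^sub>C y))\<^sup>2 = (cmod (cinner x y))\<^sup>2 / (norm y)\<^sup>2"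
    using assms by (simp add: c_def norm_scaleC norm_divide norm_mult field_simps power2_eq_square)
  ultimately show ?thesis
    unfolding c_def [symmetric] norm_diff_power2 by simp
qed

lemma cmod_cinner_le: "cmod (cinner x y) \<le> norm x * norm y"
proof (cases "y = 0")
  case False
  have "(cmod (cinner x y))\<^sup>2 / (norm y)\<^sup>2 \<le> (norm x)\<^sup>2"
    using norm_minus_component [OF False, of x] zero_le_power2
    by (metis diff_ge_0_iff_ge)
  then have "(cmod (cinner x y))\<^sup>2 \<le> (norm x * norm y)\<^sup>2"
    using False by (simp add: field_simps power_mult_distrib)
  then show ?thesis
    by (rule power2_le_imp_le) simp
qed simp

lemma bounded_bilinear_cinner: "bounded_bilinear (cinner :: 'a::complex_inner \<Rightarrow> _)"
  by unfold_locales
    (auto simp: cinner_linear intro!: exI [of _ 1] cmod_cinner_le)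

lemmas tendsto_cinner = bounded_bilinear.tendsto [OF bounded_bilinear_cinner]


section \<open>Orthogonal projections and adjoints\<close>

text \<open>Projections, adjoints and polar parts are each known first through a linear relation
  between argument and value. The norm bound makes such a relation single-valued, since it
  forces the value at \<open>0\<close> to be \<open>0\<close>.\<close>

lemma operator_of_graph:
  fixes G :: "'a::complex_inner \<Rightarrow> 'b::complex_inner \<Rightarrow> bool"
  assumes add: "\<And>x y x' y'. G x y \<Longrightarrow> G x' y' \<Longrightarrow> G (x + x') (y + y')"
    and scale: "\<And>c x y. G x y \<Longrightarrow> G (c *\<^sub>C x) (c *\<^sub>C y)"
    and total: "\<And>x. \<exists>y. G x y"
    and bound: "\<And>x y. G x y \<Longrightarrow> norm y \<le> norm x * C"
  shows "\<exists>T :: 'a \<Rightarrow>\<^sub>L 'b. T \<in> bounded_operators \<and> (\<forall>x y. G x y \<longleftrightarrow> T x = y)"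
proof -
  have uniq: "y = y'" if "G x y" "G x y'" for x y y'
  proof -
    have "G (x + (-1) *\<^sub>C x) (y + (-1) *\<^sub>C y')"
      using that by (intro add scale)
    moreover have "(-1) *\<^sub>C z = - z" for z :: "'c::complex_vector"
      using scaleR_scaleC [of "-1" z] by simp
    ultimately have "norm (y - y') \<le> 0"
      using bound by fastforce
    then show ?thesis by simp
  qed
  obtain f where f: "\<And>x. G x (f x)"
    using total by metis
  have f_eq: "G x y \<longleftrightarrow> f x = y" for x y
    using f uniq by blast
  have "bounded_linear f"
  proof (rule bounded_linear_intro)
    show "f (x + y) = f x + f y" for x y
      using add [OF f f] f_eq by blast
    show "f (r *\<^sub>R x) = r *\<^sub>R f x" for r x
      unfolding scaleR_scaleC using scale [OF f] f_eq by blast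
    show "norm (f x) \<le> norm x * C" for x
      using bound [OF f] .
  qed
  then have "blinfun_apply (Blinfun f) = f"
    by (rule bounded_linear_Blinfun_apply)
  moreover have "f (c *\<^sub>C x) = c *\<^sub>C f x" for c x
    using scale [OF f] f_eq by blast
  ultimately show ?thesis
    using f_eq by (intro exI [of _ "Blinfun f"]) (auto simp: bounded_operators_def)
qed

lemma bounded_operators_scaleC:
  "T \<in> bounded_operators \<Longrightarrow> T (c *\<^sub>C x) = c *\<^sub>C T x"
  by (simp add: bounded_operators_def)

text \<open>A minimizing sequence for the distance to \<open>M\<close> is Cauchy by the parallelogram law, and
  at the nearest point the component of \<open>x - p\<close> along any \<open>m \<in> M\<close> vanishes, since
  removing it would bring \<open>x\<close> nearer.\<close>

lemma orthogonal_decomposition: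
  fixes M :: "'a::chilbert_space set"
  assumes "closed M" and M: "complex_vector.subspace M"
  shows "\<exists>p\<in>M. \<forall>m\<in>M. cinner (x - p) m = 0"
proof -
  note sub = complex_vector.subspace_add [OF M] complex_vector.subspace_scale [OF M]
  define S where "S = (\<lambda>m. (norm (x - m))\<^sup>2) ` M"
  define d where "d = Inf S"
  have "0 \<in> M"
    by (rule complex_vector.subspace_0 [OF M])
  then have "S \<noteq> {}"
    by (auto simp: S_def)
  have "bdd_below S"
    by (rule bdd_belowI [of _ 0]) (auto simp: S_def)
  have d_le: "d \<le> (norm (x - m))\<^sup>2" if "m \<in> M" for m
    unfolding d_def by (rule cInf_lower) (use that \<open>bdd_below S\<close> in \<open>auto simp: S_def\<close>)
  have "\<exists>m\<in>M. (norm (x - m))\<^sup>2 < d + 1 / real (Suc n)" for n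
    using cInf_lessD [OF \<open>S \<noteq> {}\<close>, of "d + 1 / real (Suc n)"] unfolding d_def [symmetric]
    by (auto simp: S_def)
  then obtain m where m: "m n \<in> M" and near: "(norm (x - m n))\<^sup>2 < d + 1 / real (Suc n)" for n
    by metis
  have dist: "(norm (m i - m j))\<^sup>2 \<le> 2 / real (Suc i) + 2 / real (Suc j)" for i j
  proof -
    define c where "c = (1/2) *\<^sub>R (m i + m j)"
    have "c \<in> M"
      unfolding c_def scaleR_scaleC by (intro sub m)
    have sum: "(x - m i) + (x - m j) = 2 *\<^sub>R (x - c)"
      by (simp add: c_def algebra_simps scaleR_2)
    have diff: "(x - m i) - (x - m j) = m j - m i"
      by simp
    have "(norm (m j - m i))\<^sup>2 + (norm (2 *\<^sub>R (x - c)))\<^sup>2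
        = 2 * (norm (x - m i))\<^sup>2 + 2 * (norm (x - m j))\<^sup>2"
      using norm_add_power2 [of "x - m i" "x - m j"] norm_diff_power2 [of "x - m i" "x - m j"]
      unfolding sum diff by simp
    moreover have "4 * d \<le> (norm (2 *\<^sub>R (x - c)))\<^sup>2"
      using d_le [OF \<open>c \<in> M\<close>] by (simp add: power_mult_distrib)
    ultimately show ?thesis
      using near [of i] near [of j] by (simp add: norm_minus_commute)
  qed
  have "Cauchy m"
  proof (rule CauchyI)
    fix e :: real
    assume "0 < e"
    then obtain N where N: "inverse (real (Suc N)) < e\<^sup>2 / 4"
      using reals_Archimedean [of "e\<^sup>2 / 4"] by auto
    have "norm (m i - m j) < e" if "i \<ge> N" "j \<ge> N" for i j
    proof -
      have "2 / real (Suc k) \<le> 2 * inverse (real (Suc N))" if "k \<ge> N" for k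
        using that by (simp add: field_simps)
      from this [OF \<open>i \<ge> N\<close>] this [OF \<open>j \<ge> N\<close>] have "(norm (m i - m j))\<^sup>2 < e\<^sup>2"
        using dist [of i j] N by linarith
      then show ?thesis
        using \<open>0 < e\<close> by (intro power2_less_imp_less [of _ e]) simp_all
    qed
    then show "\<exists>N. \<forall>i\<ge>N. \<forall>j\<ge>N. norm (m i - m j) < e"
      by blast
  qed
  then obtain p where p: "m \<longlonglongrightarrow> p"
    by (auto simp: Cauchy_convergent_iff convergent_def)
  have "p \<in> M"
    using closed_sequentially [OF \<open>closed M\<close>] m p by blast
  have lim1: "(\<lambda>n. (norm (x - m n))\<^sup>2) \<longlonglongrightarrow> (norm (x - p))\<^sup>2"
    by (intro tendsto_intros p)
  have lim2: "(\<lambda>n. d + 1 / real (Suc n)) \<longlonglongrightarrow> d"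
    using tendsto_add [OF tendsto_const LIMSEQ_inverse_real_of_nat, of d]
    by (simp add: inverse_eq_divide)
  have "(norm (x - p))\<^sup>2 \<le> d"
    by (rule LIMSEQ_le [OF lim1 lim2]) (use near less_imp_le in blast)
  show ?thesis
  proof (intro bexI [OF _ \<open>p \<in> M\<close>] ballI)
    fix k
    assume "k \<in> M"
    show "cinner (x - p) k = 0"
    proof (cases "k = 0")
      case False
      define c where "c = cinner (x - p) k / complex_of_real ((norm k)\<^sup>2)"
      have "p + c *\<^sub>C k \<in> M"
        using \<open>p \<in> M\<close> \<open>k \<in> M\<close> by (intro sub)
      then have "(norm (x - p))\<^sup>2 \<le> (norm (x - p - c *\<^sub>C k))\<^sup>2"
        using d_le [of "p + c *\<^sub>C k"] \<open>(norm (x - p))\<^sup>2 \<le> d\<close>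
        unfolding diff_diff_eq by linarith
      also have "\<dots> = (norm (x - p))\<^sup>2 - (cmod (cinner (x - p) k))\<^sup>2 / (norm k)\<^sup>2"
        unfolding c_def by (rule norm_minus_component [OF False])
      finally have "(cmod (cinner (x - p) k))\<^sup>2 / (norm k)\<^sup>2 \<le> 0"
        by simp
      then show ?thesis
        using False by (simp add: divide_le_0_iff)
    qed simp
  qed
qed

lemma orthogonal_projection_exists:
  fixes M :: "'a::chilbert_space set"
  assumes "closed M" and M: "complex_vector.subspace M"
  shows "\<exists>P :: 'a \<Rightarrow>\<^sub>L 'a. is_projection P \<and>
    (\<forall>x p. P x = p \<longleftrightarrow> p \<in> M \<and> (\<forall>m\<in>M. cinner (x - p) m = 0))"
proof -
  define G where "G = (\<lambda>x p. p \<in> M \<and> (\<forall>m\<in>M. cinner (x - p) m = 0))"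
  have "\<exists>P :: 'a \<Rightarrow>\<^sub>L 'a. P \<in> bounded_operators \<and> (\<forall>x p. G x p \<longleftrightarrow> P x = p)"
  proof (rule operator_of_graph [of G 1])
    show "G (x + x') (p + p')" if "G x p" "G x' p'" for x x' p p'
      using that complex_vector.subspace_add [OF M]
      by (auto simp: G_def cinner_linear algebra_simps)
    show "G (c *\<^sub>C x) (c *\<^sub>C p)" if "G x p" for c x p
      using that complex_vector.subspace_scale [OF M]
      by (auto simp: G_def cinner_linear)
    show "\<exists>p. G x p" for x
      using orthogonal_decomposition [OF assms, of x] by (auto simp: G_def)
    show "norm p \<le> norm x * 1" if "G x p" for x p
    proof -
      have "cinner (x - p) p = 0"
        using that by (simp add: G_def)
      then have "(norm x)\<^sup>2 = (norm (x - p))\<^sup>2 + (norm p)\<^sup>2"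
        using norm_add_power2 [of "x - p" p] by simp
      then have "(norm p)\<^sup>2 \<le> (norm x)\<^sup>2"
        by simp
      then have "norm p \<le> norm x"
        by (rule power2_le_imp_le) simp
      then show ?thesis
        by simp
    qed
  qed
  then obtain P :: "'a \<Rightarrow>\<^sub>L 'a" where P: "P \<in> bounded_operators" "\<And>x p. G x p \<longleftrightarrow> P x = p"
    by blast
  have graph: "G x (P x)" for x
    by (simp add: P(2))
  then have mem: "P x \<in> M" and orth: "m \<in> M \<Longrightarrow> cinner (x - P x) m = 0" for x m
    by (auto simp: G_def)
  have "G (P x) (P x)" for x
    using mem by (simp add: G_def)
  then have "P (P x) = P x" for x
    by (simp only: P(2))
  moreover have "cinner (P x) y = cinner x (P y)" for x y
  proof -
    have "cinner x (P y) = cinner (P x) (P y)"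
      using orth [OF mem, of x y] by (simp add: cinner_linear)
    moreover have "cinner (P x) y = cinner (P x) (P y)"
      using orth [OF mem, of y x] cinner_eq_zero_commute [of "y - P y" "P x"]
      by (simp add: cinner_linear)
    ultimately show ?thesis by simp
  qed
  ultimately have "is_projection P"
    using P(1) unfolding is_projection_def by (intro conjI blinfun_eqI adj_eqI) simp_all
  moreover have "P x = p \<longleftrightarrow> p \<in> M \<and> (\<forall>m\<in>M. cinner (x - p) m = 0)" for x p
    using P(2) [of x p] unfolding G_def by blast
  ultimately show ?thesis
    by blast
qed

text \<open>The representing vector is orthogonal to the kernel of \<open>f\<close>: that kernel has codimension
  at most one, so a single vector \<open>u\<close> in its complement, suitably scaled, suffices.\<close>

lemma riesz_representation:
  fixes f :: "'a::chilbert_space \<Rightarrow> complex"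
  assumes f: "bounded_linear f" and scale: "\<And>c x. f (c *\<^sub>C x) = c * f x"
  shows "\<exists>y. \<forall>x. f x = cinner x y"
proof (cases "\<forall>x. f x = 0")
  case True
  then show ?thesis by (intro exI [of _ 0]) simp
next
  case False
  then obtain x0 where "f x0 \<noteq> 0" by blast
  define M where "M = {x. f x = 0}"
  have "closed M"
    unfolding M_def
    by (intro closed_Collect_eq linear_continuous_on f continuous_on_const)
  moreover have "complex_vector.subspace M"
    using linear_simps [OF f] scale
    by (auto simp: complex_vector.subspace_def M_def)
  ultimately obtain p where p: "p \<in> M" "\<And>m. m \<in> M \<Longrightarrow> cinner (x0 - p) m = 0"
    using orthogonal_decomposition [of M x0] by blast
  define u where "u = x0 - p"
  have "f u \<noteq> 0"
    using \<open>f x0 \<noteq> 0\<close> p(1) by (simp add: u_def M_def linear_simps [OF f])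
  then have "u \<noteq> 0"
    using linear_simps(3) [OF f] by auto
  show ?thesis
  proof (intro exI allI)
    fix x
    have "x - (f x / f u) *\<^sub>C u \<in> M"
      using \<open>f u \<noteq> 0\<close> by (simp add: M_def linear_simps [OF f] scale)
    then have "cinner (x - (f x / f u) *\<^sub>C u) u = 0"
      using p(2) cinner_eq_zero_commute unfolding u_def by blast
    then have "cinner x u = f x / f u * complex_of_real ((norm u)\<^sup>2)"
      by (simp add: cinner_linear cinner_self_norm)
    then show "f x = cinner x (cnj (f u / complex_of_real ((norm u)\<^sup>2)) *\<^sub>C u)"
      using \<open>f u \<noteq> 0\<close> \<open>u \<noteq> 0\<close> by (simp add: cinner_scaleC_right)
  qed
qed

lemma adj_exists:
  fixes T :: "'a::chilbert_space \<Rightarrow>\<^sub>L 'b::chilbert_space"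
  assumes T: "T \<in> bounded_operators"
  shows cinner_adj: "cinner (T x) y = cinner x (adj T y)"
    and adj_bounded_operators: "adj T \<in> bounded_operators"
    and norm_adj_le: "norm (adj T) \<le> norm T"
proof -
  define G where "G = (\<lambda>y s. \<forall>x. cinner (T x) y = cinner x s)"
  have bound: "norm s \<le> norm y * norm T" if "G y s" for y s
  proof -
    have "(norm s)\<^sup>2 = Re (cinner (T s) y)"
      using that by (simp add: G_def norm_power2_eq_Re_cinner)
    also have "\<dots> \<le> norm (T s) * norm y"
      using complex_Re_le_cmod cmod_cinner_le order_trans by blast
    also have "\<dots> \<le> norm T * norm s * norm y"
      by (intro mult_right_mono norm_blinfun) simp
    finally have "norm s * norm s \<le> norm s * (norm y * norm T)"
      by (simp add: power2_eq_square mult_ac)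
    then show ?thesis
      by (cases "norm s = 0") (auto simp: mult_le_cancel_left)
  qed
  have "\<exists>S :: 'b \<Rightarrow>\<^sub>L 'a. S \<in> bounded_operators \<and> (\<forall>y s. G y s \<longleftrightarrow> S y = s)"
  proof (rule operator_of_graph [of G "norm T"])
    show "G (y + y') (s + s')" if "G y s" "G y' s'" for y y' s s'
      using that by (simp add: G_def cinner_linear)
    show "G (c *\<^sub>C y) (c *\<^sub>C s)" if "G y s" for c y s
      using that by (simp add: G_def cinner_linear)
    show "\<exists>s. G y s" for y
    proof -
      have "bounded_linear (\<lambda>x. cinner (T x) y)"
        using bounded_linear_compose [OF bounded_bilinear.bounded_linear_left
            [OF bounded_bilinear_cinner] blinfun.bounded_linear_right] .
      moreover have "cinner (T (c *\<^sub>C x)) y = c * cinner (T x) y" for c x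
        using T by (simp add: bounded_operators_scaleC cinner_scaleC_left)
      ultimately show ?thesis
        unfolding G_def by (rule riesz_representation)
    qed
    show "norm s \<le> norm y * norm T" if "G y s" for y s
      using that by (rule bound)
  qed
  then obtain S :: "'b \<Rightarrow>\<^sub>L 'a" where S: "S \<in> bounded_operators" "\<And>y s. G y s \<longleftrightarrow> S y = s"
    by blast
  have eq: "cinner (T x) y = cinner x (S y)" for x y
    using S(2) by (auto simp: G_def)
  then have "adj T = S"
    by (rule adj_eqI)
  then show "cinner (T x) y = cinner x (adj T y)" "adj T \<in> bounded_operators"
    using eq S(1) by simp_all
  show "norm (adj T) \<le> norm T"
  proof (rule norm_blinfun_bound)
    show "norm (adj T y) \<le> norm T * norm y" for y
      using bound [of y "S y"] S(2) by (simp add: \<open>adj T = S\<close> mult.commute)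
  qed simp
qed

lemma cinner_adj':
  "T \<in> bounded_operators \<Longrightarrow> cinner (adj T x) y = cinner x (T y)"
  by (metis cinner_adj cinner_commute)

lemma adj_adj: "T \<in> bounded_operators \<Longrightarrow> adj (adj T) = T"
  by (rule adj_eqI) (rule cinner_adj')

lemma bounded_operators_closed:
  "S \<in> bounded_operators \<Longrightarrow> T \<in> bounded_operators \<Longrightarrow> S + T \<in> bounded_operators"
  "S \<in> bounded_operators \<Longrightarrow> T \<in> bounded_operators \<Longrightarrow> S - T \<in> bounded_operators"
  "T \<in> bounded_operators \<Longrightarrow> c *\<^sub>C T \<in> bounded_operators"
  "T \<in> bounded_operators \<Longrightarrow> r *\<^sub>R T \<in> bounded_operators"
  "U \<in> bounded_operators \<Longrightarrow> V \<in> bounded_operators \<Longrightarrow> U o\<^sub>L V \<in> bounded_operators"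
  "id_blinfun \<in> bounded_operators"
  by (auto simp: bounded_operators_def plus_blinfun.rep_eq minus_blinfun.rep_eq
      scaleC_blinfun.rep_eq scaleR_blinfun.rep_eq scaleC_add_right scaleC_scaleC scaleR_scaleC
      mult.commute complex_vector.scale_right_diff_distrib)


lemma adj_add:
  assumes "S \<in> bounded_operators" "T \<in> bounded_operators"
  shows "adj (S + T) = adj S + adj T"
  by (rule adj_eqI) (simp add: assms plus_blinfun.rep_eq cinner_linear cinner_adj)

lemma adj_diff:
  assumes "S \<in> bounded_operators" "T \<in> bounded_operators"
  shows "adj (S - T) = adj S - adj T"
  by (rule adj_eqI) (simp add: assms minus_blinfun.rep_eq cinner_linear cinner_adj)

lemma adj_scaleC:
  assumes "T \<in> bounded_operators"
  shows "adj (c *\<^sub>C T) = cnj c *\<^sub>C adj T"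
  by (rule adj_eqI) (simp add: assms scaleC_blinfun.rep_eq cinner_linear cinner_adj)

lemma adj_compose:
  assumes "S \<in> bounded_operators" "T \<in> bounded_operators"
  shows "adj (S o\<^sub>L T) = adj T o\<^sub>L adj S"
  by (rule adj_eqI) (simp add: assms cinner_adj)

lemma adj_id [simp]: "adj id_blinfun = id_blinfun"
  by (rule adj_eqI) simp

lemma projection_apply:
  assumes "is_projection P"
  shows "P (P x) = P x" "cinner (P x) y = cinner x (P y)"
  using assms cinner_adj [of P x y] unfolding is_projection_def
  by (metis blinfun_apply_blinfun_compose, metis)

lemma blinfun_eq_iff: "S = T \<longleftrightarrow> (\<forall>x. blinfun_apply S x = T x)"
  by (metis blinfun_eqI)

lemma compose_eq_iff: "S o\<^sub>L T = S' o\<^sub>L T' \<longleftrightarrow> (\<forall>x. S (T x) = S' (T' x))"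
  by (metis blinfun_apply_blinfun_compose blinfun_eqI)


lemma compose_id [simp]: "id_blinfun o\<^sub>L T = T" "T o\<^sub>L id_blinfun = T"
  by (simp_all add: blinfun_eqI)

lemmas compose_bilinear_simps =
  bounded_bilinear.add_left [OF bounded_bilinear_blinfun_compose]
  bounded_bilinear.add_right [OF bounded_bilinear_blinfun_compose]
  bounded_bilinear.diff_left [OF bounded_bilinear_blinfun_compose]
  bounded_bilinear.diff_right [OF bounded_bilinear_blinfun_compose]
  bounded_bilinear.scaleR_left [OF bounded_bilinear_blinfun_compose]
  bounded_bilinear.scaleR_right [OF bounded_bilinear_blinfun_compose]


section \<open>Square roots\<close>

text \<open>Writing a square root of \<open>I - B\<close> as \<open>I - Y\<close> turns the equation \<open>(I - Y)\<^sup>2 = I - B\<close>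
  into the fixed point equation \<open>Y = (B + Y\<^sup>2) / 2\<close>, which is solved by iteration from \<open>0\<close>.
  All iterates are polynomials in \<open>B\<close>.\<close>

primrec sqrt_iterate :: "('a::real_normed_vector \<Rightarrow>\<^sub>L 'a) \<Rightarrow> nat \<Rightarrow> 'a \<Rightarrow>\<^sub>L 'a" where
  "sqrt_iterate B 0 = 0"
| "sqrt_iterate B (Suc n) = (1/2) *\<^sub>R (B + (sqrt_iterate B n o\<^sub>L sqrt_iterate B n))"

text \<open>This is the same iteration for the number \<open>1\<close> in place of \<open>B\<close>. As the polynomials
  have nonnegative coefficients, it dominates the operator iteration for every \<open>B\<close> with
  \<open>norm B \<le> 1\<close>, and it increases to a limit.\<close>

primrec sqrt_majorant :: "nat \<Rightarrow> real" where
  "sqrt_majorant 0 = 0"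
| "sqrt_majorant (Suc n) = (1 + (sqrt_majorant n)\<^sup>2) / 2"

lemma sqrt_majorant_bounds: "0 \<le> sqrt_majorant n" "sqrt_majorant n \<le> 1"
  by (induction n) (auto simp: power_le_one)

lemma sqrt_majorant_mono: "sqrt_majorant n \<le> sqrt_majorant (Suc n)"
proof -
  have "0 \<le> (1 - sqrt_majorant n)\<^sup>2"
    by simp
  then show ?thesis
    by (simp add: power2_diff)
qed

lemma norm_sqrt_iterate_le:
  assumes "norm B \<le> 1"
  shows "norm (sqrt_iterate B n) \<le> sqrt_majorant n"
proof (induction n)
  case (Suc n)
  have "norm (sqrt_iterate B n o\<^sub>L sqrt_iterate B n) \<le> (sqrt_majorant n)\<^sup>2"
    using norm_blinfun_compose mult_mono [OF Suc Suc] sqrt_majorant_bounds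
    unfolding power2_eq_square by (metis norm_ge_zero order_trans)
  then show ?case
    using assms norm_triangle_ineq [of B "sqrt_iterate B n o\<^sub>L sqrt_iterate B n"]
    by simp
qed simp

text \<open>Both increments obey the same recursion, because
  \<open>X\<^sup>2 - Y\<^sup>2 = (X - Y) X + Y (X - Y)\<close> holds also without commutativity; so the
  telescoping sum of the operator increments is dominated by a convergent one.\<close>

lemma norm_sqrt_iterate_diff_le:
  assumes "norm B \<le> 1"
  shows "norm (sqrt_iterate B (Suc n) - sqrt_iterate B n)
    \<le> sqrt_majorant (Suc n) - sqrt_majorant n"
proof (induction n)
  case 0
  then show ?case using assms by simp
next
  case (Suc n)
  define X Y where "X = sqrt_iterate B (Suc n)" and "Y = sqrt_iterate B n"
  define a b where "a = sqrt_majorant (Suc n)" and "b = sqrt_majorant n"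
  have X: "norm X \<le> a" and Y: "norm Y \<le> b" and XY: "norm (X - Y) \<le> a - b"
    using norm_sqrt_iterate_le [OF assms] Suc by (simp_all only: X_def Y_def a_def b_def)
  have "0 \<le> a" "0 \<le> b" "b \<le> a"
    unfolding a_def b_def by (rule sqrt_majorant_bounds sqrt_majorant_mono)+
  have "sqrt_iterate B (Suc (Suc n)) - sqrt_iterate B (Suc n)
      = (1/2) *\<^sub>R (B + (X o\<^sub>L X)) - (1/2) *\<^sub>R (B + (Y o\<^sub>L Y))"
    by (simp add: X_def Y_def)
  also have "\<dots> = (1/2) *\<^sub>R (((X - Y) o\<^sub>L X) + (Y o\<^sub>L (X - Y)))"
    by (simp add: compose_bilinear_simps algebra_simps)
  also have "norm \<dots> \<le> (1/2) * (norm ((X - Y) o\<^sub>L X) + norm (Y o\<^sub>L (X - Y)))"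
    by (simp add: norm_triangle_ineq)
  also have "\<dots> \<le> (1/2) * ((a - b) * a + b * (a - b))"
  proof -
    have "norm ((X - Y) o\<^sub>L X) \<le> (a - b) * a"
      using norm_blinfun_compose mult_mono [OF XY X] \<open>b \<le> a\<close>
      by (metis diff_ge_0_iff_ge norm_ge_zero order_trans)
    moreover have "norm (Y o\<^sub>L (X - Y)) \<le> b * (a - b)"
      using norm_blinfun_compose mult_mono [OF Y XY] \<open>0 \<le> b\<close>
      by (metis norm_ge_zero order_trans)
    ultimately show ?thesis by simp
  qed
  also have "\<dots> = sqrt_majorant (Suc (Suc n)) - sqrt_majorant (Suc n)"
    unfolding sqrt_majorant.simps(2) [of "Suc n"] a_def [symmetric]
    unfolding a_def sqrt_majorant.simps(2) [of n] b_def [symmetric]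
    by (simp add: power2_eq_square algebra_simps)
  finally show ?case .
qed

lemma sqrt_iterate_convergent:
  fixes B :: "'a::banach \<Rightarrow>\<^sub>L 'a"
  assumes "norm B \<le> 1"
  obtains Y where "sqrt_iterate B \<longlonglongrightarrow> Y"
proof -
  have "incseq sqrt_majorant"
    by (rule incseq_SucI) (rule sqrt_majorant_mono)
  then obtain q where "sqrt_majorant \<longlonglongrightarrow> q"
    using incseq_convergent sqrt_majorant_bounds by metis
  then have "summable (\<lambda>n. sqrt_majorant (Suc n) - sqrt_majorant n)"
    by (rule telescope_summable)
  then have "summable (\<lambda>n. sqrt_iterate B (Suc n) - sqrt_iterate B n)"
    by (rule summable_comparison_test' [of _ 0]) (rule norm_sqrt_iterate_diff_le [OF assms])
  then have "convergent (\<lambda>n. \<Sum>i<n. sqrt_iterate B (Suc i) - sqrt_iterate B i)"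
    by (simp add: summable_iff_convergent)
  then show thesis
    unfolding sum_lessThan_telescope by (auto simp: convergent_def intro: that)
qed

text \<open>Self-adjointness, complex linearity and commutation relations are inherited from \<open>B\<close> by
  the polynomials in \<open>B\<close> and by their norm limit.\<close>

lemma operator_sqrt_exists:
  fixes B :: "'a::chilbert_space \<Rightarrow>\<^sub>L 'a"
  assumes "norm B \<le> 1" and B: "B \<in> bounded_operators" "adj B = B"
  obtains S :: "'a \<Rightarrow>\<^sub>L 'a" where "S \<in> bounded_operators" "adj S = S" "S o\<^sub>L S = id_blinfun - B"
    "\<And>C. C o\<^sub>L B = B o\<^sub>L C \<Longrightarrow> C o\<^sub>L S = S o\<^sub>L C"
proof -
  obtain Y where Y: "sqrt_iterate B \<longlonglongrightarrow> Y"
    using sqrt_iterate_convergent [OF assms(1)] by blast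
  have "(\<lambda>n. (1/2) *\<^sub>R (B + (sqrt_iterate B n o\<^sub>L sqrt_iterate B n)))
      \<longlonglongrightarrow> (1/2) *\<^sub>R (B + (Y o\<^sub>L Y))"
    by (intro tendsto_intros bounded_bilinear.tendsto [OF bounded_bilinear_blinfun_compose] Y)
  moreover have "(\<lambda>n. (1/2) *\<^sub>R (B + (sqrt_iterate B n o\<^sub>L sqrt_iterate B n))) \<longlonglongrightarrow> Y"
    using LIMSEQ_Suc [OF Y] by simp
  ultimately have fixed_point: "(1/2) *\<^sub>R (B + (Y o\<^sub>L Y)) = Y"
    by (rule LIMSEQ_unique)
  have square: "(id_blinfun - Y) o\<^sub>L (id_blinfun - Y) = id_blinfun - B"
  proof -
    have "B + (Y o\<^sub>L Y) = Y + Y"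
      using arg_cong [OF fixed_point, of "\<lambda>Z. 2 *\<^sub>R Z"] by (simp add: scaleR_2)
    then show ?thesis
      by (simp add: compose_bilinear_simps algebra_simps)
  qed
  have commute: "C o\<^sub>L (id_blinfun - Y) = (id_blinfun - Y) o\<^sub>L C" if C: "C o\<^sub>L B = B o\<^sub>L C" for C
  proof -
    have "C o\<^sub>L sqrt_iterate B n = sqrt_iterate B n o\<^sub>L C" for n
    proof (induction n)
      case (Suc n)
      then have "C o\<^sub>L (sqrt_iterate B n o\<^sub>L sqrt_iterate B n)
          = (sqrt_iterate B n o\<^sub>L sqrt_iterate B n) o\<^sub>L C"
        by (simp add: compose_eq_iff)
      then show ?case
        using C by (simp add: compose_bilinear_simps)
    qed simp
    moreover have "(\<lambda>n. C o\<^sub>L sqrt_iterate B n) \<longlonglongrightarrow> (C o\<^sub>L Y)"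
      by (intro bounded_bilinear.tendsto [OF bounded_bilinear_blinfun_compose] tendsto_const Y)
    moreover have "(\<lambda>n. sqrt_iterate B n o\<^sub>L C) \<longlonglongrightarrow> (Y o\<^sub>L C)"
      by (intro bounded_bilinear.tendsto [OF bounded_bilinear_blinfun_compose] tendsto_const Y)
    ultimately have "C o\<^sub>L Y = Y o\<^sub>L C"
      using LIMSEQ_unique by simp
    then show ?thesis
      by (simp add: compose_bilinear_simps)
  qed
  have adj: "adj (id_blinfun - Y) = id_blinfun - Y"
  proof (rule adj_eqI)
    fix x y
    have "cinner (sqrt_iterate B n x) y = cinner x (sqrt_iterate B n y)" for n x y
    proof (induction n arbitrary: x y)
      case (Suc n)
      then show ?case
        using cinner_adj [OF B(1)] B(2)
        by (simp add: plus_blinfun.rep_eq scaleR_blinfun.rep_eq cinner_linear)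
    qed simp
    moreover have "(\<lambda>n. cinner (sqrt_iterate B n x) y) \<longlonglongrightarrow> cinner (Y x) y"
      by (intro tendsto_cinner blinfun.tendsto tendsto_const Y)
    moreover have "(\<lambda>n. cinner x (sqrt_iterate B n y)) \<longlonglongrightarrow> cinner x (Y y)"
      by (intro tendsto_cinner blinfun.tendsto tendsto_const Y)
    ultimately have "cinner (Y x) y = cinner x (Y y)"
      using LIMSEQ_unique by simp
    then show "cinner ((id_blinfun - Y) x) y = cinner x ((id_blinfun - Y) y)"
      by (simp add: minus_blinfun.rep_eq cinner_linear)
  qed
  have "id_blinfun - Y \<in> bounded_operators"
  proof -
    \<comment> \<open>Complex linearity is commutation with the scalar operators.\<close>
    have "(c *\<^sub>C id_blinfun) o\<^sub>L (id_blinfun - Y) = (id_blinfun - Y) o\<^sub>L (c *\<^sub>C id_blinfun)" for c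
      using B(1) by (intro commute)
        (simp add: compose_eq_iff scaleC_blinfun.rep_eq bounded_operators_scaleC)
    then show ?thesis
      by (auto simp: compose_eq_iff bounded_operators_def scaleC_blinfun.rep_eq)
  qed
  with adj square commute show thesis
    by (intro that)
qed


section \<open>Polar parts and partial isometries\<close>

text \<open>From \<open>R\<^sup>2 = T\<^sup>* T\<close> one has \<open>norm (R x) = norm (T x)\<close>, so \<open>R x \<mapsto> T x\<close> is isometric
  and extends by continuity to the closure of the range of \<open>R\<close>; it is extended by \<open>0\<close> to the
  orthogonal complement. Describing the extension by sequences \<open>R (x n) \<longlonglongrightarrow> P z\<close> makes the
  intertwining property immediate: applying \<open>L\<close> to such a sequence for \<open>z\<close> gives one for
  \<open>L z\<close>, and \<open>T (L (x n)) = K (T (x n))\<close> tends to \<open>K (V z)\<close>.\<close>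

lemma polar_part_exists:
  fixes T :: "'a::chilbert_space \<Rightarrow>\<^sub>L 'b::chilbert_space" and R :: "'a \<Rightarrow>\<^sub>L 'a"
  assumes T: "T \<in> bounded_operators" and R: "R \<in> bounded_operators" "adj R = R"
    and square: "R o\<^sub>L R = adj T o\<^sub>L T"
  obtains V P where "V \<in> bounded_operators" "is_projection P"
    "\<And>x. norm (V x) = norm (P x)" "V o\<^sub>L R = T"
    "\<And>K L. \<lbrakk>L \<in> bounded_operators; adj L = L; L o\<^sub>L R = R o\<^sub>L L; K o\<^sub>L T = T o\<^sub>L L\<rbrakk>
      \<Longrightarrow> K o\<^sub>L V = V o\<^sub>L L"
proof -
  have norm_R: "norm (R x) = norm (T x)" for x
  proof -
    have "cinner (R x) (R x) = cinner x ((R o\<^sub>L R) x)"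
      using cinner_adj [OF R(1)] R(2) by simp
    also have "\<dots> = cinner (T x) (T x)"
      unfolding square by (simp add: cinner_adj [OF T])
    finally show ?thesis
      by (simp add: cinner_self_norm flip: of_real_power)
  qed
  have T_converges: "\<exists>w. (\<lambda>n. T (x n)) \<longlonglongrightarrow> w" if "(\<lambda>n. R (x n)) \<longlonglongrightarrow> z" for x z
  proof -
    have "Cauchy (\<lambda>n. R (x n))"
      using that by (rule LIMSEQ_imp_Cauchy)
    then have "Cauchy (\<lambda>n. T (x n))"
      unfolding Cauchy_iff
      by (simp add: norm_R flip: blinfun.diff_right)
    then show ?thesis
      by (simp add: Cauchy_convergent_iff convergent_def)
  qed

  define M where "M = closure (range R)"
  have M_iff: "z \<in> M \<longleftrightarrow> (\<exists>x. (\<lambda>n. R (x n)) \<longlonglongrightarrow> z)" for z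
  proof -
    have "z \<in> M \<longleftrightarrow> (\<exists>y. (\<forall>n. y n \<in> range R) \<and> y \<longlonglongrightarrow> z)"
      unfolding M_def by (rule closure_sequential)
    also have "\<dots> \<longleftrightarrow> (\<exists>x. (\<lambda>n. R (x n)) \<longlonglongrightarrow> z)"
    proof
      assume "\<exists>y. (\<forall>n. y n \<in> range R) \<and> y \<longlonglongrightarrow> z"
      then obtain y where y: "\<And>n. y n \<in> range R" "y \<longlonglongrightarrow> z"
        by blast
      then have "\<forall>n. \<exists>a. y n = R a"
        by blast
      then obtain x where "\<And>n. y n = R (x n)"
        by metis
      then have "y = (\<lambda>n. R (x n))"
        by blast
      then show "\<exists>x. (\<lambda>n. R (x n)) \<longlonglongrightarrow> z"
        using y by blast
    next
      assume "\<exists>x. (\<lambda>n. R (x n)) \<longlonglongrightarrow> z"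
      then obtain x where "(\<lambda>n. R (x n)) \<longlonglongrightarrow> z" ..
      then show "\<exists>y. (\<forall>n. y n \<in> range R) \<and> y \<longlonglongrightarrow> z"
        by (intro exI [of _ "\<lambda>n. R (x n)"]) simp
    qed
    finally show ?thesis .
  qed
  have tendsto_scaleC: "(\<lambda>n. c *\<^sub>C f n) \<longlonglongrightarrow> c *\<^sub>C l" if "f \<longlonglongrightarrow> l"
    for c and f :: "nat \<Rightarrow> 'c::complex_inner" and l
    using that by (rule bounded_linear.tendsto [OF bounded_linear_scaleC])
  have "complex_vector.subspace M"
    unfolding complex_vector.subspace_def
  proof (intro conjI ballI allI)
    show "0 \<in> M"
      unfolding M_iff by (intro exI [of _ "\<lambda>n. 0"]) simp
    show "y + z \<in> M" if yz: "y \<in> M" "z \<in> M" for y z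
    proof -
      obtain a b where "(\<lambda>n. R (a n)) \<longlonglongrightarrow> y" "(\<lambda>n. R (b n)) \<longlonglongrightarrow> z"
        using yz M_iff by blast
      then have "(\<lambda>n. R (a n + b n)) \<longlonglongrightarrow> y + z"
        unfolding blinfun.add_right by (rule tendsto_add)
      then show ?thesis
        unfolding M_iff by (rule exI [of _ "\<lambda>n. a n + b n"])
    qed
    show "c *\<^sub>C z \<in> M" if z: "z \<in> M" for c z
    proof -
      obtain a where "(\<lambda>n. R (a n)) \<longlonglongrightarrow> z"
        using z M_iff by blast
      then have "(\<lambda>n. R (c *\<^sub>C a n)) \<longlonglongrightarrow> c *\<^sub>C z"
        unfolding bounded_operators_scaleC [OF R(1)] by (rule tendsto_scaleC)
      then show ?thesis
        unfolding M_iff by (rule exI [of _ "\<lambda>n. c *\<^sub>C a n"])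
    qed
  qed
  moreover have "closed M"
    by (simp add: M_def)
  ultimately obtain P where P: "is_projection P"
    "\<And>z p. P z = p \<longleftrightarrow> p \<in> M \<and> (\<forall>m\<in>M. cinner (z - p) m = 0)"
    using orthogonal_projection_exists [of M] by metis
  have P_mem: "P z \<in> M" and P_orth: "m \<in> M \<Longrightarrow> cinner (z - P z) m = 0" for z m
    using P(2) [of z "P z"] by auto
  have P_linear: "P (y + z) = P y + P z" "P (c *\<^sub>C z) = c *\<^sub>C P z" for y z c
    using P(1) by (simp_all add: blinfun.add_right is_projection_def bounded_operators_scaleC)

  define G where "G = (\<lambda>z w. \<exists>x. (\<lambda>n. R (x n)) \<longlonglongrightarrow> P z \<and> (\<lambda>n. T (x n)) \<longlonglongrightarrow> w)"
  have norm_G: "norm w = norm (P z)" if "G z w" for z w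
  proof -
    from that obtain x where x: "(\<lambda>n. R (x n)) \<longlonglongrightarrow> P z" "(\<lambda>n. T (x n)) \<longlonglongrightarrow> w"
      by (auto simp: G_def)
    have "(\<lambda>n. norm (T (x n))) \<longlonglongrightarrow> norm (P z)"
      using tendsto_norm [OF x(1)] by (simp add: norm_R)
    then show ?thesis
      using tendsto_norm [OF x(2)] LIMSEQ_unique by blast
  qed
  have "\<exists>V :: 'a \<Rightarrow>\<^sub>L 'b. V \<in> bounded_operators \<and> (\<forall>z w. G z w \<longleftrightarrow> V z = w)"
  proof (rule operator_of_graph [of G "norm P"])
    show "G (y + z) (v + w)" if "G y v" "G z w" for y z v w
    proof -
      from that obtain a b where "(\<lambda>n. R (a n)) \<longlonglongrightarrow> P y" "(\<lambda>n. T (a n)) \<longlonglongrightarrow> v"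
        "(\<lambda>n. R (b n)) \<longlonglongrightarrow> P z" "(\<lambda>n. T (b n)) \<longlonglongrightarrow> w"
        by (auto simp: G_def)
      then have "(\<lambda>n. R (a n + b n)) \<longlonglongrightarrow> P (y + z)" "(\<lambda>n. T (a n + b n)) \<longlonglongrightarrow> v + w"
        unfolding P_linear blinfun.add_right by (auto intro: tendsto_add)
      then show ?thesis
        unfolding G_def by (intro exI [of _ "\<lambda>n. a n + b n"] conjI)
    qed
    show "G (c *\<^sub>C z) (c *\<^sub>C w)" if "G z w" for c z w
    proof -
      from that obtain a where "(\<lambda>n. R (a n)) \<longlonglongrightarrow> P z" "(\<lambda>n. T (a n)) \<longlonglongrightarrow> w"
        by (auto simp: G_def)
      then have "(\<lambda>n. R (c *\<^sub>C a n)) \<longlonglongrightarrow> P (c *\<^sub>C z)" "(\<lambda>n. T (c *\<^sub>C a n)) \<longlonglongrightarrow> c *\<^sub>C w"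
        unfolding P_linear bounded_operators_scaleC [OF R(1)] bounded_operators_scaleC [OF T]
        by (auto intro: tendsto_scaleC)
      then show ?thesis
        unfolding G_def by (intro exI [of _ "\<lambda>n. c *\<^sub>C a n"] conjI)
    qed
    show "\<exists>w. G z w" for z
      using P_mem [of z] T_converges unfolding M_iff G_def by blast
    show "norm w \<le> norm z * norm P" if "G z w" for z w
      using norm_G [OF that] norm_blinfun [of P z] by (simp add: mult.commute)
  qed
  then obtain V :: "'a \<Rightarrow>\<^sub>L 'b" where V: "V \<in> bounded_operators" "\<And>z w. G z w \<longleftrightarrow> V z = w"
    by blast
  show thesis
  proof (rule that [OF V(1) P(1)])
    show "norm (V x) = norm (P x)" for x
      using norm_G V(2) by blast
    show "V o\<^sub>L R = T"
    proof (rule blinfun_eqI)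
      fix x
      have "R x \<in> M"
        unfolding M_def by (rule subsetD [OF closure_subset]) simp
      then have "P (R x) = R x"
        by (simp add: P(2))
      then have "G (R x) (T x)"
        unfolding G_def by (intro exI [of _ "\<lambda>n. x"]) simp
      then show "(V o\<^sub>L R) x = T x"
        by (simp add: V(2))
    qed
    fix K :: "'b \<Rightarrow>\<^sub>L 'b" and L :: "'a \<Rightarrow>\<^sub>L 'a"
    assume L: "L \<in> bounded_operators" "adj L = L" and LR: "L o\<^sub>L R = R o\<^sub>L L"
      and KT: "K o\<^sub>L T = T o\<^sub>L L"
    \<comment> \<open>The closed range of \<open>R\<close> is invariant under the self-adjoint \<open>L\<close>, hence so is its
      complement, and \<open>L\<close> commutes with \<open>P\<close>.\<close>
    have L_lim: "(\<lambda>n. R (L (x n))) \<longlonglongrightarrow> L m" if "(\<lambda>n. R (x n)) \<longlonglongrightarrow> m" for x m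
      using blinfun.tendsto [OF tendsto_const [of L] that] LR by (simp add: compose_eq_iff)
    have L_M: "L m \<in> M" if m: "m \<in> M" for m
    proof -
      obtain x where "(\<lambda>n. R (x n)) \<longlonglongrightarrow> m"
        using m M_iff by blast
      then show ?thesis
        unfolding M_iff by (intro exI [of _ "\<lambda>n. L (x n)"] L_lim)
    qed
    have "cinner (L z - L (P z)) m = 0" if "m \<in> M" for z m
      using P_orth [OF L_M [OF that], of z] cinner_adj [OF L(1)] L(2)
      by (simp add: blinfun.diff_right [symmetric])
    then have LP: "P (L z) = L (P z)" for z
      using L_M [OF P_mem] by (simp add: P(2))
    show "K o\<^sub>L V = V o\<^sub>L L"
    proof (rule blinfun_eqI)
      fix z
      have "G z (V z)"
        by (simp add: V(2))
      then obtain x where x: "(\<lambda>n. R (x n)) \<longlonglongrightarrow> P z" "(\<lambda>n. T (x n)) \<longlonglongrightarrow> V z"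
        by (auto simp: G_def)
      have "(\<lambda>n. T (L (x n))) \<longlonglongrightarrow> K (V z)"
        using blinfun.tendsto [OF tendsto_const [of K] x(2)] KT by (simp add: compose_eq_iff)
      then have "G (L z) (K (V z))"
        using L_lim [OF x(1)] unfolding G_def LP by (intro exI [of _ "\<lambda>n. L (x n)"] conjI)
      then show "(K o\<^sub>L V) z = (V o\<^sub>L L) z"
        by (simp add: V(2))
    qed
  qed
qed

text \<open>For every \<open>x\<close>, the operator \<open>V W\<close> annihilates \<open>W\<^sup>* (I - P) W x\<close>. If \<open>x\<close> is orthogonal to
  its kernel, this gives \<open>(I - P) W x = 0\<close>, so \<open>W x\<close> lies where \<open>V\<close> is isometric.\<close>

lemma partial_isometry_compose_unitary:
  fixes V :: "'a::chilbert_space \<Rightarrow>\<^sub>L 'b::chilbert_space" and W :: "'a \<Rightarrow>\<^sub>L 'a"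
  assumes V: "V \<in> bounded_operators" and P: "is_projection P"
    and norm_V: "\<And>x. norm (V x) = norm (P x)"
    and W: "W \<in> bounded_operators" "adj W o\<^sub>L W = id_blinfun" "W o\<^sub>L adj W = id_blinfun"
  shows "is_partial_isometry (V o\<^sub>L W)"
  unfolding is_partial_isometry_def
proof (intro conjI allI impI)
  show "V o\<^sub>L W \<in> bounded_operators"
    using V W(1) by (rule bounded_operators_closed)
  have W_inv: "adj W (W x) = x" "W (adj W x) = x" for x
    using W(2,3) by (metis blinfun_apply_blinfun_compose id_blinfun.rep_eq)+
  fix x
  assume orth: "\<forall>z. (V o\<^sub>L W) z = 0 \<longrightarrow> cinner x z = 0"
  define y where "y = W x - P (W x)"
  have "P y = 0"
    by (simp add: y_def blinfun.diff_right projection_apply [OF P])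
  then have "V y = 0"
    using norm_V [of y] by simp
  then have "cinner x (adj W y) = 0"
    using orth W_inv by simp
  then have "cinner (W x) y = 0"
    by (simp add: cinner_adj [OF W(1)])
  moreover have "cinner (P (W x)) y = 0"
    using \<open>P y = 0\<close> by (simp add: projection_apply [OF P])
  ultimately have "cinner y y = 0"
    by (simp add: y_def cinner_linear)
  then have "P (W x) = W x"
    by (simp add: y_def cinner_self_norm)
  moreover have "norm (W x) = norm x"
  proof -
    have "cinner (W x) (W x) = cinner x x"
      by (simp add: cinner_adj [OF W(1)] W_inv)
    then show ?thesis
      by (simp add: cinner_self_norm flip: of_real_power)
  qed
  ultimately show "norm ((V o\<^sub>L W) x) = norm x"
    by (simp add: norm_V)
qed

text \<open>The point is that \<open>norm (T\<^sup>* T x) \<le> norm (T x)\<close>, while \<open>\<langle>x, T\<^sup>* T x\<rangle> = norm (T x)\<^sup>2\<close>;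
  expanding \<open>norm (x - T\<^sup>* T x)\<^sup>2\<close> leaves at most \<open>norm x\<^sup>2 - norm (T x)\<^sup>2\<close>.\<close>

lemma norm_defect_le:
  assumes T: "T \<in> bounded_operators" and "norm T \<le> 1"
  shows "norm (id_blinfun - (adj T o\<^sub>L T)) \<le> 1"
proof (rule norm_blinfun_bound)
  fix x
  have "norm (adj T) \<le> 1"
    using norm_adj_le [OF T] assms(2) by linarith
  then have "norm (adj T (T x)) \<le> norm (T x)"
    using norm_blinfun [of "adj T" "T x"] mult_right_mono [of "norm (adj T)" 1 "norm (T x)"]
    by simp
  then have "(norm (adj T (T x)))\<^sup>2 \<le> (norm (T x))\<^sup>2"
    by (simp add: power_mono)
  moreover have "Re (cinner x (adj T (T x))) = (norm (T x))\<^sup>2"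
    by (simp add: cinner_adj [OF T, symmetric] norm_power2_eq_Re_cinner)
  ultimately have "(norm (x - adj T (T x)))\<^sup>2 \<le> (norm x)\<^sup>2"
    unfolding norm_diff_power2 using zero_le_power2 [of "norm (T x)"] by linarith
  then have "norm (x - adj T (T x)) \<le> norm x"
    by (rule power2_le_imp_le) simp
  then show "norm ((id_blinfun - (adj T o\<^sub>L T)) x) \<le> 1 * norm x"
    by (simp add: minus_blinfun.rep_eq)
qed simp

text \<open>This is the operator form of \<open>cos t \<plusminus> \<i> sin t\<close>; the conditions on \<open>c\<close> say that
  \<open>c = \<i>\<close> or \<open>c = - \<i>\<close>.\<close>

lemma unitary_of_square_roots:
  fixes R D :: "'a::chilbert_space \<Rightarrow>\<^sub>L 'a"
  assumes R: "R \<in> bounded_operators" "adj R = R" and D: "D \<in> bounded_operators" "adj D = D"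
    and commute: "R o\<^sub>L D = D o\<^sub>L R"
    and squares: "(R o\<^sub>L R) + (D o\<^sub>L D) = id_blinfun"
    and c: "cnj c = - c" "c * c = -1"
  shows "adj (R + c *\<^sub>C D) o\<^sub>L (R + c *\<^sub>C D) = id_blinfun"
    and "(R + c *\<^sub>C D) o\<^sub>L adj (R + c *\<^sub>C D) = id_blinfun"
proof -
  have adj: "adj (R + c *\<^sub>C D) = R - c *\<^sub>C D"
    using R D c by (simp add: adj_add adj_scaleC bounded_operators_closed)
  have comm: "R (D x) = D (R x)" for x
    using commute by (simp add: compose_eq_iff)
  have sq: "R (R x) + D (D x) = x" for x
    using arg_cong [OF squares, of "\<lambda>S. blinfun_apply S x"] by (simp add: plus_blinfun.rep_eq)
  have sq': "R (R x) = x - D (D x)" for x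
    using sq [of x] by (simp add: algebra_simps)
  have minus: "(-1) *\<^sub>C x = - x" for x :: 'a
    using scaleR_scaleC [of "-1" x] by simp
  note apply_simps = plus_blinfun.rep_eq minus_blinfun.rep_eq scaleC_blinfun.rep_eq
    blinfun.add_right blinfun.diff_right bounded_operators_scaleC [OF R(1)]
    bounded_operators_scaleC [OF D(1)] scaleC_add_right
    complex_vector.scale_right_diff_distrib scaleC_scaleC
  show "adj (R + c *\<^sub>C D) o\<^sub>L (R + c *\<^sub>C D) = id_blinfun"
    unfolding adj by (rule blinfun_eqI) (simp add: apply_simps c comm sq' minus)
  show "(R + c *\<^sub>C D) o\<^sub>L adj (R + c *\<^sub>C D) = id_blinfun"
    unfolding adj by (rule blinfun_eqI) (simp add: apply_simps c comm sq' minus)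
qed

text \<open>Take commuting self-adjoint square roots \<open>R\<close> of \<open>T\<^sup>* T\<close> and \<open>D\<close> of \<open>I - T\<^sup>* T\<close>. Then
  \<open>R\<close> is the mean of the unitaries \<open>R \<plusminus> \<i> D\<close>, and multiplying by the polar part \<open>V\<close> makes
  \<open>T = V R\<close> the mean of the partial isometries \<open>V (R \<plusminus> \<i> D)\<close>. If \<open>K T = T L\<close>, then \<open>L\<close>
  commutes with \<open>T\<^sup>* T\<close>, hence with \<open>R\<close> and \<open>D\<close>, so both partial isometries inherit the
  relation.\<close>

lemma contraction_mean_of_partial_isometries:
  fixes T :: "'a::chilbert_space \<Rightarrow>\<^sub>L 'b::chilbert_space"
  assumes T: "T \<in> bounded_operators" and "norm T \<le> 1"
  obtains V\<^sub>1 V\<^sub>2 where "is_partial_isometry V\<^sub>1" "is_partial_isometry V\<^sub>2"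
    "T = (1/2) *\<^sub>R (V\<^sub>1 + V\<^sub>2)"
    "\<And>K L. \<lbrakk>is_projection K; is_projection L; K o\<^sub>L T = T o\<^sub>L L\<rbrakk>
      \<Longrightarrow> K o\<^sub>L V\<^sub>1 = V\<^sub>1 o\<^sub>L L \<and> K o\<^sub>L V\<^sub>2 = V\<^sub>2 o\<^sub>L L"
proof -
  define A where "A = adj T o\<^sub>L T"
  have A: "A \<in> bounded_operators" "adj A = A"
    using T by (simp_all add: A_def bounded_operators_closed adj_bounded_operators
        adj_compose adj_adj)
  have "norm (adj T) \<le> 1"
    using norm_adj_le [OF T] assms(2) by linarith
  then have "norm A \<le> 1"
    unfolding A_def
    using norm_blinfun_compose [of "adj T" T] mult_le_one [OF _ _ assms(2)] by fastforce
  then obtain D where D: "D \<in> bounded_operators" "adj D = D" "D o\<^sub>L D = id_blinfun - A"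
    and D_commute: "\<And>C. C o\<^sub>L A = A o\<^sub>L C \<Longrightarrow> C o\<^sub>L D = D o\<^sub>L C"
    using operator_sqrt_exists A by blast
  define B where "B = id_blinfun - A"
  have "norm B \<le> 1" "B \<in> bounded_operators" "adj B = B"
    using norm_defect_le [OF T assms(2)] A
    by (simp_all add: B_def A_def [symmetric] bounded_operators_closed adj_diff)
  then obtain R where R: "R \<in> bounded_operators" "adj R = R" "R o\<^sub>L R = id_blinfun - B"
    and R_commute': "\<And>C. C o\<^sub>L B = B o\<^sub>L C \<Longrightarrow> C o\<^sub>L R = R o\<^sub>L C"
    using operator_sqrt_exists [of B] by blast
  have R_commute: "C o\<^sub>L R = R o\<^sub>L C" if "C o\<^sub>L A = A o\<^sub>L C" for C
    using that by (intro R_commute') (simp add: B_def compose_bilinear_simps)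
  have RR: "R o\<^sub>L R = A"
    using R(3) by (simp add: B_def)
  have DR: "D o\<^sub>L R = R o\<^sub>L D"
    by (intro R_commute D_commute [symmetric]) simp
  obtain V P where V: "V \<in> bounded_operators" and P: "is_projection P"
    and norm_V: "\<And>x. norm (V x) = norm (P x)" and VR: "V o\<^sub>L R = T"
    and V_intertwines: "\<And>K L. \<lbrakk>L \<in> bounded_operators; adj L = L; L o\<^sub>L R = R o\<^sub>L L;
      K o\<^sub>L T = T o\<^sub>L L\<rbrakk> \<Longrightarrow> K o\<^sub>L V = V o\<^sub>L L"
    using polar_part_exists [OF T R(1,2)] RR unfolding A_def by blast
  define W where "W = (\<lambda>c. R + c *\<^sub>C D)"
  have partial_isometry: "is_partial_isometry (V o\<^sub>L W c)" if "cnj c = - c" "c * c = -1" for c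
  proof -
    have "(R o\<^sub>L R) + (D o\<^sub>L D) = id_blinfun"
      by (simp add: RR D(3))
    note unitary = unitary_of_square_roots [OF R(1,2) D(1,2) DR [symmetric] this that]
    show ?thesis
      by (rule partial_isometry_compose_unitary [OF V P norm_V])
        (use unitary R(1) D(1) in \<open>auto simp: W_def bounded_operators_closed\<close>)
  qed
  have intertwines: "K o\<^sub>L (V o\<^sub>L W c) = (V o\<^sub>L W c) o\<^sub>L L"
    if K: "is_projection K" and L: "is_projection L" and KT: "K o\<^sub>L T = T o\<^sub>L L" for K L c
  proof -
    have L': "L \<in> bounded_operators" "adj L = L" and K': "K \<in> bounded_operators" "adj K = K"
      using K L by (simp_all add: is_projection_def)
    \<comment> \<open>Taking adjoints in \<open>K T = T L\<close> gives \<open>T\<^sup>* K = L T\<^sup>*\<close>.\<close>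
    have "adj T o\<^sub>L K = L o\<^sub>L adj T"
      using arg_cong [OF KT, of adj] T L' K' by (simp add: adj_compose)
    then have "L o\<^sub>L A = A o\<^sub>L L"
      using KT unfolding A_def by (simp add: compose_eq_iff) metis
    then have LR: "L o\<^sub>L R = R o\<^sub>L L" and LD: "L o\<^sub>L D = D o\<^sub>L L"
      by (simp_all add: R_commute D_commute)
    have "K o\<^sub>L V = V o\<^sub>L L"
      by (rule V_intertwines [OF L' LR KT])
    moreover have "L o\<^sub>L W c = W c o\<^sub>L L"
      using LR LD by (simp add: W_def compose_eq_iff plus_blinfun.rep_eq scaleC_blinfun.rep_eq
          blinfun.add_right bounded_operators_scaleC [OF L'(1)])
    ultimately show ?thesis
      by (simp add: compose_eq_iff)
  qed
  have "T = (1/2) *\<^sub>R ((V o\<^sub>L W \<i>) + (V o\<^sub>L W (- \<i>)))"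
  proof -
    have "W \<i> + W (- \<i>) = 2 *\<^sub>R R"
      by (simp add: W_def scaleR_2 complex_vector.scale_minus_left)
    then have "(V o\<^sub>L W \<i>) + (V o\<^sub>L W (- \<i>)) = 2 *\<^sub>R T"
      by (simp add: VR compose_bilinear_simps flip: compose_bilinear_simps(2))
    then show ?thesis by simp
  qed
  then show thesis
    by (intro that [of "V o\<^sub>L W \<i>" "V o\<^sub>L W (- \<i>)"])
      (auto intro: partial_isometry intertwines)
qed


section \<open>Semi-normalizers as intertwiners of invariant projections\<close>

lemma compression_eq_zero_iff:
  "(id_blinfun - L) o\<^sub>L A o\<^sub>L L = 0 \<longleftrightarrow> (\<forall>x. L (A (L x)) = A (L x))"
  by (auto simp: blinfun_eq_iff minus_blinfun.rep_eq)

lemma lat_iff: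
  "L \<in> lat \<A> \<longleftrightarrow> is_projection L \<and> (\<forall>A\<in>\<A>. \<forall>x. L (A (L x)) = A (L x))"
  by (simp add: lat_def compression_eq_zero_iff)

lemma lat_projection: "L \<in> lat \<A> \<Longrightarrow> is_projection L"
  by (simp add: lat_iff)

lemma reflexive_algebra_iff:
  assumes "reflexive_algebra \<A>"
  shows "A \<in> \<A> \<longleftrightarrow> A \<in> bounded_operators \<and> (\<forall>L\<in>lat \<A>. \<forall>x. L (A (L x)) = A (L x))"
  using assms unfolding reflexive_algebra_def compression_eq_zero_iff by blast

text \<open>If \<open>K T = T L\<close>, then \<open>T\<^sup>* K = L T\<^sup>*\<close>, so that invariance passes from \<open>B K = K B K\<close>
  to \<open>(T\<^sup>* B T) L = T\<^sup>* B K T = T\<^sup>* K B K T = L (T\<^sup>* B T) L\<close>. Conversely,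
  given \<open>L\<close>, the range of \<open>K\<close> is the closed span of the vectors \<open>B T L x\<close>, described here
  by its orthogonal complement \<open>N\<close>: it contains the range of \<open>T L\<close> because \<open>\<B>\<close> is
  unital, it is invariant because \<open>\<B>\<close> is closed under products, and it is orthogonal to
  \<open>T (x - L x)\<close> because \<open>T\<^sup>* B T\<close> leaves the range of \<open>L\<close> invariant.\<close>

lemma compression_mem_iff_intertwines_lat:
  fixes T :: "'a::chilbert_space \<Rightarrow>\<^sub>L 'b::chilbert_space"
  assumes T: "T \<in> bounded_operators" and \<A>: "reflexive_algebra \<A>" and \<B>: "reflexive_algebra \<B>"
  shows "(\<forall>B\<in>\<B>. adj T o\<^sub>L B o\<^sub>L T \<in> \<A>) \<longleftrightarrow> (\<forall>L\<in>lat \<A>. \<exists>K\<in>lat \<B>. K o\<^sub>L T = T o\<^sub>L L)"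
proof (intro iffI ballI)
  fix B
  assume inter: "\<forall>L\<in>lat \<A>. \<exists>K\<in>lat \<B>. K o\<^sub>L T = T o\<^sub>L L" and "B \<in> \<B>"
  have "L (adj T (B (T (L x)))) = adj T (B (T (L x)))" if L: "L \<in> lat \<A>" for L x
  proof -
    obtain K where K: "K \<in> lat \<B>" and KT: "K o\<^sub>L T = T o\<^sub>L L"
      using inter L by blast
    have "adj T o\<^sub>L K = L o\<^sub>L adj T"
      using arg_cong [OF KT, of adj] T K L
      by (simp add: adj_compose lat_iff is_projection_def)
    moreover have "K (B (K y)) = B (K y)" for y
      using K \<open>B \<in> \<B>\<close> by (simp add: lat_iff)
    ultimately show ?thesis
      using KT unfolding compose_eq_iff by metis
  qed
  then show "adj T o\<^sub>L B o\<^sub>L T \<in> \<A>"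
    using T \<open>B \<in> \<B>\<close> reflexive_algebra_iff [OF \<B>]
    by (auto simp: reflexive_algebra_iff [OF \<A>] bounded_operators_closed adj_bounded_operators)
next
  fix L
  assume comp: "\<forall>B\<in>\<B>. adj T o\<^sub>L B o\<^sub>L T \<in> \<A>" and L: "L \<in> lat \<A>"
  have L_proj: "is_projection L"
    using L by (simp add: lat_iff)
  have L_comp: "L (adj T (B (T (L x)))) = adj T (B (T (L x)))" if "B \<in> \<B>" for B x
    using L comp that by (fastforce simp: lat_iff)
  define N where "N = {z. \<forall>B\<in>\<B>. \<forall>x. cinner z (B (T (L x))) = 0}"
  have "closed N"
  proof -
    have "N = (\<Inter>B\<in>\<B>. \<Inter>x. {z. cinner z (blinfun_apply B (T (L x))) = 0})"
      by (auto simp: N_def)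
    moreover have "closed {z. cinner z y = 0}" for y :: 'b
      by (intro closed_Collect_eq linear_continuous_on continuous_on_const
          bounded_bilinear.bounded_linear_left [OF bounded_bilinear_cinner])
    ultimately show ?thesis
      by auto
  qed
  moreover have "complex_vector.subspace N"
    by (auto simp: complex_vector.subspace_def N_def cinner_linear)
  ultimately obtain Q where Q: "is_projection Q"
    "\<And>z p. Q z = p \<longleftrightarrow> p \<in> N \<and> (\<forall>m\<in>N. cinner (z - p) m = 0)"
    using orthogonal_projection_exists [of N] by metis
  have Q_mem: "Q z \<in> N" for z
    using Q(2) [of z "Q z"] by simp
  have Q_fix: "Q z = z" if "z \<in> N" for z
    using that by (simp add: Q(2))
  have Q_zero_iff: "Q z = 0 \<longleftrightarrow> (\<forall>m\<in>N. cinner z m = 0)" for z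
    using complex_vector.subspace_0 [OF \<open>complex_vector.subspace N\<close>] by (simp add: Q(2))
  define K where "K = id_blinfun - Q"
  have K_apply: "K z = z - Q z" for z
    by (simp add: K_def minus_blinfun.rep_eq)
  have "is_projection K"
    using Q(1) by (simp add: is_projection_def K_def bounded_operators_closed adj_diff
        compose_bilinear_simps)
  moreover have "K (B (K z)) = B (K z)" if "B \<in> \<B>" for B z
  proof -
    have B: "B \<in> bounded_operators"
      using that reflexive_algebra_iff [OF \<B>] by blast
    have "adj B m \<in> N" if "m \<in> N" for m
      unfolding N_def
    proof (intro CollectI ballI allI)
      fix B' x
      assume "B' \<in> \<B>"
      then have "B o\<^sub>L B' \<in> \<B>"
        using \<open>B \<in> \<B>\<close> by (intro reflexive_algebra_unital_algebra(4) [OF \<B>])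
      then have "cinner m ((B o\<^sub>L B') (T (L x))) = 0"
        using \<open>m \<in> N\<close> by (simp add: N_def del: blinfun_apply_blinfun_compose)
      then show "cinner (adj B m) (B' (T (L x))) = 0"
        by (simp add: cinner_adj' [OF B])
    qed
    moreover have "Q (K z) = 0"
      by (simp add: K_apply blinfun.diff_right projection_apply [OF Q(1)])
    ultimately have "cinner (B (K z)) m = 0" if "m \<in> N" for m
      using that by (simp add: cinner_adj [OF B] Q_zero_iff)
    then have "Q (B (K z)) = 0"
      by (simp add: Q_zero_iff)
    then show ?thesis
      by (simp add: K_apply)
  qed
  ultimately have "K \<in> lat \<B>"
    by (simp add: lat_iff)
  moreover have "K o\<^sub>L T = T o\<^sub>L L"
  proof (rule blinfun_eqI)
    fix x
    have "cinner (T (L x)) m = 0" if "m \<in> N" for m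
      using that reflexive_algebra_unital_algebra(1) [OF \<B>] cinner_eq_zero_commute
      by (fastforce simp: N_def)
    then have "Q (T (L x)) = 0"
      by (simp add: Q_zero_iff)
    moreover have "T (x - L x) \<in> N"
      unfolding N_def
    proof (intro CollectI ballI allI)
      fix B y
      assume "B \<in> \<B>"
      have "cinner (T (x - L x)) (B (T (L y))) = cinner (x - L x) (L (adj T (B (T (L y)))))"
        by (simp add: cinner_adj [OF T] L_comp [OF \<open>B \<in> \<B>\<close>])
      also have "\<dots> = 0"
        by (simp add: projection_apply [OF L_proj] blinfun.diff_right
            flip: projection_apply(2) [OF L_proj])
      finally show "cinner (T (x - L x)) (B (T (L y))) = 0" .
    qed
    then have "Q (T (x - L x)) = T (x - L x)"
      by (rule Q_fix)
    ultimately have "Q (T x) = T x - T (L x)"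
      by (simp add: blinfun.diff_right)
    then show "(K o\<^sub>L T) x = (T o\<^sub>L L) x"
      by (simp add: K_apply)
  qed
  ultimately show "\<exists>K\<in>lat \<B>. K o\<^sub>L T = T o\<^sub>L L"
    by blast
qed

lemma semi_normalizers_iff:
  assumes "reflexive_algebra \<A>" "reflexive_algebra \<B>"
  shows "T \<in> semi_normalizers \<B> \<A> \<longleftrightarrow>
    T \<in> bounded_operators \<and> (\<forall>L\<in>lat \<A>. \<exists>K\<in>lat \<B>. K o\<^sub>L T = T o\<^sub>L L)"
  using compression_mem_iff_intertwines_lat [OF _ assms] by (auto simp: semi_normalizers_def)

text \<open>The second half of the definition is the first half for \<open>T\<^sup>*\<close>, with the algebras exchanged.
  Taking adjoints converts the resulting relation \<open>L T\<^sup>* = T\<^sup>* K\<close> back to \<open>K T = T L\<close>.\<close>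

lemma normalizers_iff:
  assumes "reflexive_algebra \<A>" "reflexive_algebra \<B>"
  shows "T \<in> normalizers \<B> \<A> \<longleftrightarrow> T \<in> bounded_operators \<and>
    (\<forall>L\<in>lat \<A>. \<exists>K\<in>lat \<B>. K o\<^sub>L T = T o\<^sub>L L) \<and> (\<forall>K\<in>lat \<B>. \<exists>L\<in>lat \<A>. K o\<^sub>L T = T o\<^sub>L L)"
proof (cases "T \<in> bounded_operators")
  case T: True
  have "(L o\<^sub>L adj T = adj T o\<^sub>L K) \<longleftrightarrow> (K o\<^sub>L T = T o\<^sub>L L)"
    if K: "K \<in> lat \<B>" and L: "L \<in> lat \<A>" for K L
  proof -
    have sa: "K \<in> bounded_operators" "adj K = K" "L \<in> bounded_operators" "adj L = L"
      using K L by (simp_all add: lat_iff is_projection_def)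
    have "adj (K o\<^sub>L T) = adj T o\<^sub>L K" "adj (T o\<^sub>L L) = L o\<^sub>L adj T"
      using T sa by (simp_all add: adj_compose)
    moreover have "adj (adj T o\<^sub>L K) = K o\<^sub>L T" "adj (L o\<^sub>L adj T) = T o\<^sub>L L"
      using T sa by (simp_all add: adj_compose adj_adj adj_bounded_operators)
    ultimately show ?thesis
      by metis
  qed
  then have "(\<forall>A\<in>\<A>. T o\<^sub>L A o\<^sub>L adj T \<in> \<B>) \<longleftrightarrow> (\<forall>K\<in>lat \<B>. \<exists>L\<in>lat \<A>. K o\<^sub>L T = T o\<^sub>L L)"
    using compression_mem_iff_intertwines_lat [OF adj_bounded_operators [OF T] assms(2,1)]
    by (simp add: adj_adj [OF T])
  then show ?thesis
    using T compression_mem_iff_intertwines_lat [OF T assms] by (simp add: normalizers_def)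
next
  case False
  then show ?thesis
    unfolding normalizers_def by blast
qed


section \<open>Linear combinations of partial isometries\<close>

text \<open>The hypothesis on \<open>S\<close> is shaped to hold for semi-normalizers and normalizers alike: both
  are determined by the pairs of projections \<open>K\<close>, \<open>L\<close> that an operator intertwines, and
  membership persists when the set of these pairs grows.\<close>

lemma span_of_partial_isometries:
  fixes T :: "'a::chilbert_space \<Rightarrow>\<^sub>L 'b::chilbert_space"
  assumes T: "T \<in> bounded_operators"
    and S: "\<And>V. \<lbrakk>V \<in> bounded_operators; \<And>K L. \<lbrakk>is_projection K; is_projection L;
      K o\<^sub>L T = T o\<^sub>L L\<rbrakk> \<Longrightarrow> K o\<^sub>L V = V o\<^sub>L L\<rbrakk> \<Longrightarrow> V \<in> S"
  shows "T \<in> cspan {V \<in> S. is_partial_isometry V}"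
proof -
  define r where "r = norm T + 1"
  have "r > 0"
    by (simp add: r_def add_nonneg_pos)
  define T' where "T' = inverse r *\<^sub>R T"
  have "T' \<in> bounded_operators"
    using T by (simp add: T'_def bounded_operators_closed)
  moreover have "norm T' \<le> 1"
    using \<open>r > 0\<close> by (simp add: T'_def field_simps) (simp add: r_def)
  ultimately obtain V\<^sub>1 V\<^sub>2 where V: "is_partial_isometry V\<^sub>1" "is_partial_isometry V\<^sub>2"
    and T': "T' = (1/2) *\<^sub>R (V\<^sub>1 + V\<^sub>2)"
    and inter: "\<And>K L. \<lbrakk>is_projection K; is_projection L; K o\<^sub>L T' = T' o\<^sub>L L\<rbrakk>
      \<Longrightarrow> K o\<^sub>L V\<^sub>1 = V\<^sub>1 o\<^sub>L L \<and> K o\<^sub>L V\<^sub>2 = V\<^sub>2 o\<^sub>L L"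
    using contraction_mean_of_partial_isometries [of T'] by blast
  have "K o\<^sub>L T' = T' o\<^sub>L L" if "K o\<^sub>L T = T o\<^sub>L L" for K L
    using that by (simp add: T'_def compose_bilinear_simps)
  then have "V\<^sub>1 \<in> S" "V\<^sub>2 \<in> S"
    using V inter by (auto intro!: S simp: is_partial_isometry_def)
  moreover have "T = complex_of_real (r / 2) *\<^sub>C (V\<^sub>1 + V\<^sub>2)"
  proof -
    have "T = r *\<^sub>R T'"
      using \<open>r > 0\<close> by (simp add: T'_def)
    then have "T = (r / 2) *\<^sub>R (V\<^sub>1 + V\<^sub>2)"
      by (simp add: T')
    then show ?thesis
      by (simp only: scaleR_scaleC)
  qed
  ultimately show ?thesis
    using V by (simp only:)
      (intro complex_vector.span_scale complex_vector.span_add complex_vector.span_base; simp)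
qed

text \<open>Since every (semi-)normalizer already lies in the linear span, constant sequences suffice.\<close>

theorem corollary5p4:
  fixes \<A> :: "('a::chilbert_space \<Rightarrow>\<^sub>L 'a) set"
    and \<B> :: "('b::chilbert_space \<Rightarrow>\<^sub>L 'b) set"
  assumes "separable_space (euclidean :: 'a topology)"
    and "separable_space (euclidean :: 'b topology)"
    and "reflexive_algebra \<A>" and "reflexive_algebra \<B>"
  shows "(\<forall>T \<in> semi_normalizers \<B> \<A>.
            \<exists>X. (\<forall>n::nat. X n \<in> cspan {V \<in> semi_normalizers \<B> \<A>. is_partial_isometry V}) \<and>
                X \<longlonglongrightarrow> T) \<and>
         (\<forall>T \<in> normalizers \<B> \<A>.
            \<exists>X. (\<forall>n::nat. X n \<in> cspan {V \<in> normalizers \<B> \<A>. is_partial_isometry V}) \<and>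
                X \<longlonglongrightarrow> T)"
proof (intro conjI ballI)
  fix T
  assume "T \<in> semi_normalizers \<B> \<A>"
  then have T: "T \<in> bounded_operators" "\<forall>L\<in>lat \<A>. \<exists>K\<in>lat \<B>. K o\<^sub>L T = T o\<^sub>L L"
    by (simp_all add: semi_normalizers_iff assms(3,4))
  have "T \<in> cspan {V \<in> semi_normalizers \<B> \<A>. is_partial_isometry V}"
  proof (rule span_of_partial_isometries [OF T(1)])
    fix V
    assume "V \<in> bounded_operators" and inter: "\<And>K L. \<lbrakk>is_projection K; is_projection L;
      K o\<^sub>L T = T o\<^sub>L L\<rbrakk> \<Longrightarrow> K o\<^sub>L V = V o\<^sub>L L"
    have "\<forall>L\<in>lat \<A>. \<exists>K\<in>lat \<B>. K o\<^sub>L V = V o\<^sub>L L"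
      using T(2) inter lat_projection by metis
    then show "V \<in> semi_normalizers \<B> \<A>"
      using \<open>V \<in> bounded_operators\<close> by (simp add: semi_normalizers_iff assms(3,4))
  qed
  then show "\<exists>X. (\<forall>n::nat. X n \<in> cspan {V \<in> semi_normalizers \<B> \<A>. is_partial_isometry V}) \<and>
      X \<longlonglongrightarrow> T"
    by (intro exI [of _ "\<lambda>n. T"]) simp
next
  fix T
  assume "T \<in> normalizers \<B> \<A>"
  then have T: "T \<in> bounded_operators" "\<forall>L\<in>lat \<A>. \<exists>K\<in>lat \<B>. K o\<^sub>L T = T o\<^sub>L L"
    "\<forall>K\<in>lat \<B>. \<exists>L\<in>lat \<A>. K o\<^sub>L T = T o\<^sub>L L"
    by (simp_all add: normalizers_iff assms(3,4))
  have "T \<in> cspan {V \<in> normalizers \<B> \<A>. is_partial_isometry V}"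
  proof (rule span_of_partial_isometries [OF T(1)])
    fix V
    assume "V \<in> bounded_operators" and inter: "\<And>K L. \<lbrakk>is_projection K; is_projection L;
      K o\<^sub>L T = T o\<^sub>L L\<rbrakk> \<Longrightarrow> K o\<^sub>L V = V o\<^sub>L L"
    have "\<forall>L\<in>lat \<A>. \<exists>K\<in>lat \<B>. K o\<^sub>L V = V o\<^sub>L L"
      using T(2) inter lat_projection by metis
    moreover have "\<forall>K\<in>lat \<B>. \<exists>L\<in>lat \<A>. K o\<^sub>L V = V o\<^sub>L L"
      using T(3) inter lat_projection by metis
    ultimately show "V \<in> normalizers \<B> \<A>"
      using \<open>V \<in> bounded_operators\<close> by (simp add: normalizers_iff assms(3,4))
  qed
  then show "\<exists>X. (\<forall>n::nat. X n \<in> cspan {V \<in> normalizers \<B> \<A>. is_partial_isometry V}) \<and>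
      X \<longlonglongrightarrow> T"
    by (intro exI [of _ "\<lambda>n. T"]) simp
qed

end
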